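(* Let $\mathbf{k}$ be a commutative unital ring, $\lambda\in\mathbf{k}$, and let $(A,m,1,r)$ be a quasitriangular infinitesimal unitary bialgebra of weight $\lambda$ with $r=\sum_i u_i\otimes v_i\in A\otimes A$. Define two binary operations $\succ,\prec$ on $A$ by $$a\succ b:=\sum_i u_i a v_i b,\qquad a\prec b:=\sum_i a u_i b v_i-\lambda ab.$$ Then $(A,\succ,\prec)$ is a dendriform algebra.
   Context: Tensor products are over $\mathbf{k}$. For $r=\sum_i u_i\otimes v_i\in A\otimes A$, set $r_{12}=\sum_i u_i\otimes v_i\otimes 1$, $r_{13}=\sum_i u_i\otimes 1\otimes v_i$, $r_{23}=\sum_i 1\otimes u_i\otimes v_i$ in the tensor product algebra $A\otimes A\otimes A$. A quasitriangular infinitesimal unitary bialgebra of weight $\lambda$ is a quadruple $(A,m,1,r)$ consisting of a unital associative $\mathbf{k}$-algebra $(A,m,1)$ and an element $r\in A\otimes A$ that is a solution of the associative Yang-Baxter equation of weight $\lambda$: $r_{13}r_{12}-r_{12}r_{23}+r_{23}r_{13}=\lambda r_{13}$. A dendriform algebra is a $\mathbf{k}$-module $D$ with two bilinear operations $\prec,\succ$ such that for all $a,b,c\in D$: $(a\prec b)\prec c=a\prec(b\prec c+b\succ c)$, $(a\succ b)\prec c=a\succ(b\prec c)$, and $a\succ(b\succ c)=(a\prec b+a\succ b)\succ c$. *)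

theory Defs
  imports "HOL-Algebra.Free_Abelian_Groups" "HOL-Algebra.Coset" "HOL-Algebra.Module"
begin

text \<open>
  HOL-Algebra's \<^locale>\<open>algebra\<close> requires a commutative multiplication; here the
  multiplication is only associative and unital.  Neither the ground ring nor the
  algebra is required to be nontrivial.
\<close>

locale unital_algebra = module R M + ring M
  for R (structure) and M (structure) +
  assumes smult_mult_left:
      "\<lbrakk>c \<in> carrier R; x \<in> carrier M; y \<in> carrier M\<rbrakk>
        \<Longrightarrow> (c \<odot>\<^bsub>M\<^esub> x) \<otimes>\<^bsub>M\<^esub> y = c \<odot>\<^bsub>M\<^esub> (x \<otimes>\<^bsub>M\<^esub> y)"
    and smult_mult_right:
      "\<lbrakk>c \<in> carrier R; x \<in> carrier M; y \<in> carrier M\<rbrakk>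
        \<Longrightarrow> x \<otimes>\<^bsub>M\<^esub> (c \<odot>\<^bsub>M\<^esub> y) = c \<odot>\<^bsub>M\<^esub> (x \<otimes>\<^bsub>M\<^esub> y)"

definition bilinear_map ::
  "('k, 'm) ring_scheme \<Rightarrow> ('k, 'a, 'n) module_scheme \<Rightarrow> ('k, 'b, 'p) module_scheme
    \<Rightarrow> ('k, 'c, 'q) module_scheme \<Rightarrow> ('a \<Rightarrow> 'b \<Rightarrow> 'c) \<Rightarrow> bool"
where
  "bilinear_map R M N P f \<longleftrightarrow>
    (\<forall>x\<in>carrier M. \<forall>y\<in>carrier N. f x y \<in> carrier P) \<and>
    (\<forall>x\<in>carrier M. \<forall>x'\<in>carrier M. \<forall>y\<in>carrier N.
        f (x \<oplus>\<^bsub>M\<^esub> x') y = f x y \<oplus>\<^bsub>P\<^esub> f x' y) \<and>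
    (\<forall>x\<in>carrier M. \<forall>y\<in>carrier N. \<forall>y'\<in>carrier N.
        f x (y \<oplus>\<^bsub>N\<^esub> y') = f x y \<oplus>\<^bsub>P\<^esub> f x y') \<and>
    (\<forall>c\<in>carrier R. \<forall>x\<in>carrier M. \<forall>y\<in>carrier N.
        f (c \<odot>\<^bsub>M\<^esub> x) y = c \<odot>\<^bsub>P\<^esub> f x y \<and> f x (c \<odot>\<^bsub>N\<^esub> y) = c \<odot>\<^bsub>P\<^esub> f x y)"


section \<open>Tensor products over a commutative ring\<close>

text \<open>
  The tensor product is the free abelian group on \<open>carrier M \<times> carrier N\<close> modulo the
  subgroup generated by the additivity relations in each argument and the balancing
  relations \<open>c x \<otimes> y = x \<otimes> c y\<close>.  Its elements are the cosets of that subgroup.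
\<close>

definition tensor_relations ::
  "('k, 'm) ring_scheme \<Rightarrow> ('k, 'a, 'n) module_scheme \<Rightarrow> ('k, 'b, 'p) module_scheme
    \<Rightarrow> ('a \<times> 'b \<Rightarrow>\<^sub>0 int) set"
where
  "tensor_relations R M N =
    {frag_of (x \<oplus>\<^bsub>M\<^esub> x', y) - (frag_of (x, y) + frag_of (x', y)) | x x' y.
        x \<in> carrier M \<and> x' \<in> carrier M \<and> y \<in> carrier N} \<union>
    {frag_of (x, y \<oplus>\<^bsub>N\<^esub> y') - (frag_of (x, y) + frag_of (x, y')) | x y y'.
        x \<in> carrier M \<and> y \<in> carrier N \<and> y' \<in> carrier N} \<union>
    {frag_of (c \<odot>\<^bsub>M\<^esub> x, y) - frag_of (x, c \<odot>\<^bsub>N\<^esub> y) | c x y.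
        c \<in> carrier R \<and> x \<in> carrier M \<and> y \<in> carrier N}"

definition tensor_null ::
  "('k, 'm) ring_scheme \<Rightarrow> ('k, 'a, 'n) module_scheme \<Rightarrow> ('k, 'b, 'p) module_scheme
    \<Rightarrow> ('a \<times> 'b \<Rightarrow>\<^sub>0 int) set"
where
  "tensor_null R M N =
    generate (free_Abelian_group (carrier M \<times> carrier N)) (tensor_relations R M N)"

definition tensor_class ::
  "('k, 'm) ring_scheme \<Rightarrow> ('k, 'a, 'n) module_scheme \<Rightarrow> ('k, 'b, 'p) module_scheme
    \<Rightarrow> ('a \<times> 'b \<Rightarrow>\<^sub>0 int) \<Rightarrow> ('a \<times> 'b \<Rightarrow>\<^sub>0 int) set"
where
  "tensor_class R M N x =
    tensor_null R M N #>\<^bsub>free_Abelian_group (carrier M \<times> carrier N)\<^esub> x"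

definition tensor_rep :: "('a \<times> 'b \<Rightarrow>\<^sub>0 int) set \<Rightarrow> ('a \<times> 'b \<Rightarrow>\<^sub>0 int)" where
  "tensor_rep X = (SOME x. x \<in> X)"

definition pure_tensor ::
  "('k, 'm) ring_scheme \<Rightarrow> ('k, 'a, 'n) module_scheme \<Rightarrow> ('k, 'b, 'p) module_scheme
    \<Rightarrow> 'a \<Rightarrow> 'b \<Rightarrow> ('a \<times> 'b \<Rightarrow>\<^sub>0 int) set"
where
  "pure_tensor R M N x y = tensor_class R M N (frag_of (x, y))"

text \<open>
  The scalar action and the multiplication are induced by \<open>c (x \<otimes> y) = c x \<otimes> y\<close> and
  \<open>(x \<otimes> y) (x' \<otimes> y') = x x' \<otimes> y y'\<close>, extended additively to representatives.  The
  fields \<open>mult\<close> and \<open>one\<close> are meaningful only if both factors are algebras.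
\<close>

definition tensor_product ::
  "('k, 'm) ring_scheme \<Rightarrow> ('k, 'a, 'n) module_scheme \<Rightarrow> ('k, 'b, 'p) module_scheme
    \<Rightarrow> ('k, ('a \<times> 'b \<Rightarrow>\<^sub>0 int) set) module"
where
  "tensor_product R M N =
    (let Q = free_Abelian_group (carrier M \<times> carrier N) Mod tensor_null R M N
     in \<lparr>carrier = carrier Q,
         mult = (\<lambda>X Y. tensor_class R M N
            (frag_extend (\<lambda>(x, y).
               frag_extend (\<lambda>(x', y'). frag_of (x \<otimes>\<^bsub>M\<^esub> x', y \<otimes>\<^bsub>N\<^esub> y')) (tensor_rep Y))
             (tensor_rep X))),
         one = pure_tensor R M N \<one>\<^bsub>M\<^esub> \<one>\<^bsub>N\<^esub>,
         zero = \<one>\<^bsub>Q\<^esub>,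
         add = monoid.mult Q,
         smult = (\<lambda>c X. tensor_class R M N
            (frag_extend (\<lambda>(x, y). frag_of (c \<odot>\<^bsub>M\<^esub> x, y)) (tensor_rep X)))\<rparr>)"

text \<open>
  The map \<open>M \<otimes> N \<rightarrow> P\<close> induced by a bilinear map \<open>f\<close>: a representative
  \<open>\<Sum>\<^sub>p n\<^sub>p p\<close> is sent to \<open>\<Sum>\<^sub>p n\<^sub>p f(p)\<close>.
\<close>

definition frag_eval :: "('c, 'q) ring_scheme \<Rightarrow> ('a \<Rightarrow> 'c) \<Rightarrow> ('a \<Rightarrow>\<^sub>0 int) \<Rightarrow> 'c" where
  "frag_eval P f x =
    (\<Oplus>\<^bsub>P\<^esub>p\<in>Poly_Mapping.keys x. [poly_mapping.lookup x p] \<cdot>\<^bsub>P\<^esub> f p)"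

definition tensor_lift ::
  "('c, 'q) ring_scheme \<Rightarrow> ('a \<Rightarrow> 'b \<Rightarrow> 'c) \<Rightarrow> ('a \<times> 'b \<Rightarrow>\<^sub>0 int) set \<Rightarrow> 'c"
where
  "tensor_lift P f X = frag_eval P (\<lambda>(x, y). f x y) (tensor_rep X)"


section \<open>The associative Yang-Baxter equation of weight \<open>\<lambda>\<close>\<close>

type_synonym 'a tensor2 = "('a \<times> 'a \<Rightarrow>\<^sub>0 int) set"
type_synonym 'a tensor3 = "('a tensor2 \<times> 'a \<Rightarrow>\<^sub>0 int) set"

text \<open>\<open>A \<otimes> A \<otimes> A\<close> is bracketed to the left.\<close>

abbreviation tensor2 ::
  "('k, 'm) ring_scheme \<Rightarrow> ('k, 'a, 'n) module_scheme \<Rightarrow> ('k, 'a tensor2) module"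
where
  "tensor2 R A \<equiv> tensor_product R A A"

abbreviation tensor3 ::
  "('k, 'm) ring_scheme \<Rightarrow> ('k, 'a, 'n) module_scheme \<Rightarrow> ('k, 'a tensor3) module"
where
  "tensor3 R A \<equiv> tensor_product R (tensor2 R A) A"

definition pure_tensor3 ::
  "('k, 'm) ring_scheme \<Rightarrow> ('k, 'a, 'n) module_scheme \<Rightarrow> 'a \<Rightarrow> 'a \<Rightarrow> 'a \<Rightarrow> 'a tensor3"
where
  "pure_tensor3 R A x y z = pure_tensor R (tensor2 R A) A (pure_tensor R A A x y) z"

definition leg12 ::
  "('k, 'm) ring_scheme \<Rightarrow> ('k, 'a, 'n) module_scheme \<Rightarrow> 'a tensor2 \<Rightarrow> 'a tensor3"
where
  "leg12 R A = tensor_lift (tensor3 R A) (\<lambda>x y. pure_tensor3 R A x y \<one>\<^bsub>A\<^esub>)"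

definition leg13 ::
  "('k, 'm) ring_scheme \<Rightarrow> ('k, 'a, 'n) module_scheme \<Rightarrow> 'a tensor2 \<Rightarrow> 'a tensor3"
where
  "leg13 R A = tensor_lift (tensor3 R A) (\<lambda>x y. pure_tensor3 R A x \<one>\<^bsub>A\<^esub> y)"

definition leg23 ::
  "('k, 'm) ring_scheme \<Rightarrow> ('k, 'a, 'n) module_scheme \<Rightarrow> 'a tensor2 \<Rightarrow> 'a tensor3"
where
  "leg23 R A = tensor_lift (tensor3 R A) (\<lambda>x y. pure_tensor3 R A \<one>\<^bsub>A\<^esub> x y)"

definition AYBE ::
  "('k, 'm) ring_scheme \<Rightarrow> ('k, 'a, 'n) module_scheme \<Rightarrow> 'k \<Rightarrow> 'a tensor2 \<Rightarrow> bool"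
where
  "AYBE R A lam r \<longleftrightarrow>
    ((leg13 R A r \<otimes>\<^bsub>tensor3 R A\<^esub> leg12 R A r)
       \<ominus>\<^bsub>tensor3 R A\<^esub> (leg12 R A r \<otimes>\<^bsub>tensor3 R A\<^esub> leg23 R A r))
       \<oplus>\<^bsub>tensor3 R A\<^esub> (leg23 R A r \<otimes>\<^bsub>tensor3 R A\<^esub> leg13 R A r)
    = lam \<odot>\<^bsub>tensor3 R A\<^esub> leg13 R A r"

locale quasitriangular_inf_unitary_bialgebra = unital_algebra R A
  for R (structure) and A (structure) +
  fixes lam and r
  assumes weight_closed: "lam \<in> carrier R"
    and r_closed: "r \<in> carrier (tensor2 R A)"
    and aybe: "AYBE R A lam r"


section \<open>Dendriform algebras\<close>

locale dendriform_algebra = module R D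
  for R (structure) and D (structure) +
  fixes prec :: "_ \<Rightarrow> _ \<Rightarrow> _" (infixl \<open>\<prec>\<^sub>D\<close> 70)
    and succ :: "_ \<Rightarrow> _ \<Rightarrow> _" (infixl \<open>\<succ>\<^sub>D\<close> 70)
  assumes prec_bilinear: "bilinear_map R D D D (\<prec>\<^sub>D)"
    and succ_bilinear: "bilinear_map R D D D (\<succ>\<^sub>D)"
    and prec_prec:
      "\<lbrakk>a \<in> carrier D; b \<in> carrier D; c \<in> carrier D\<rbrakk>
        \<Longrightarrow> (a \<prec>\<^sub>D b) \<prec>\<^sub>D c = a \<prec>\<^sub>D (b \<prec>\<^sub>D c \<oplus>\<^bsub>D\<^esub> b \<succ>\<^sub>D c)"
    and succ_prec:
      "\<lbrakk>a \<in> carrier D; b \<in> carrier D; c \<in> carrier D\<rbrakk>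
        \<Longrightarrow> (a \<succ>\<^sub>D b) \<prec>\<^sub>D c = a \<succ>\<^sub>D (b \<prec>\<^sub>D c)"
    and succ_succ:
      "\<lbrakk>a \<in> carrier D; b \<in> carrier D; c \<in> carrier D\<rbrakk>
        \<Longrightarrow> a \<succ>\<^sub>D (b \<succ>\<^sub>D c) = (a \<prec>\<^sub>D b \<oplus>\<^bsub>D\<^esub> a \<succ>\<^sub>D b) \<succ>\<^sub>D c"


section \<open>Basic facts on the construction\<close>

text \<open>
  \<open>tensor_product\<close> is a module, the pure tensors are bilinear, bilinear maps factor
  through \<open>tensor_lift\<close>, and for algebras the tensor product is again a unital algebra
  with the usual multiplication.  In particular none of the choices of representatives
  above matters, and \<open>leg12\<close>, \<open>leg13\<close>, \<open>leg23\<close> are given by the expected sums for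
  every presentation of \<open>r\<close>.
\<close>

locale tensor_pair = M: module R M + N: module R N
  for R :: "('k, 'r) ring_scheme" (structure)
  and M :: "('k, 'b, 'm) module_scheme" and N :: "('k, 'c, 'n) module_scheme"
begin

abbreviation "F \<equiv> free_Abelian_group (carrier M \<times> carrier N)"
abbreviation "H \<equiv> tensor_null R M N"
abbreviation "T \<equiv> tensor_product R M N"
abbreviation "cls \<equiv> tensor_class R M N"
abbreviation "pure \<equiv> pure_tensor R M N"

sublocale F: comm_group F by (rule abelian_free_Abelian_group)

lemma rel_sub: "tensor_relations R M N \<subseteq> carrier F"
  unfolding tensor_relations_def
  apply (auto simp: keys_frag_of dest!: subsetD[OF keys_add] subsetD[OF keys_diff] split: if_splits)
  done

lemma subH: "subgroup H F"
  unfolding tensor_null_def by (rule F.generate_is_subgroup[OF rel_sub])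

lemma H_sub: "h \<in> H \<Longrightarrow> h \<in> carrier F" using subgroup.subset[OF subH] by (rule subsetD)
lemma H_add: "h \<in> H \<Longrightarrow> k \<in> H \<Longrightarrow> h + k \<in> H" using subgroup.m_closed[OF subH] by simp
lemma H_zero: "0 \<in> H" using subgroup.one_closed[OF subH] by simp
lemma H_neg: "h \<in> H \<Longrightarrow> - h \<in> H" using subgroup.m_inv_closed[OF subH, of h] H_sub[of h] by simp

lemma H_diff: "h \<in> H \<Longrightarrow> k \<in> H \<Longrightarrow> h - k \<in> H" using H_add[of h "-k"] H_neg[of k] by simp

lemma cls_iff: "z \<in> cls x \<longleftrightarrow> z - x \<in> H"
  unfolding tensor_class_def r_coset_def by (auto, metis diff_add_cancel)

lemma cls_eq: "cls x = cls y \<longleftrightarrow> x - y \<in> H"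
proof
  assume "cls x = cls y"
  then show "x - y \<in> H" using cls_iff[of x x] H_zero cls_iff[of x y] by simp
next
  assume a: "x - y \<in> H"
  show "cls x = cls y"
    apply (auto simp: cls_iff)
    subgoal for z using H_add[OF _ a, of "z - x"] by simp
    subgoal for z using H_diff[OF _ a, of "z - y"] by simp
    done
qed

lemma F_iff: "x \<in> carrier F \<longleftrightarrow> Poly_Mapping.keys x \<subseteq> carrier M \<times> carrier N" by simp

lemma carr: "carrier T = cls ` carrier F"
  unfolding tensor_product_def Let_def tensor_class_def by (auto simp: FactGroup_def RCOSETS_def)

lemma norm: "H \<lhd> F" using F.subgroup_imp_normal subH by blast

lemma addT: "x \<in> carrier F \<Longrightarrow> y \<in> carrier F \<Longrightarrow> cls x \<oplus>\<^bsub>T\<^esub> cls y = cls (x + y)"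
  using normal.rcos_sum[OF norm, of x y]
  unfolding tensor_product_def Let_def tensor_class_def by (simp add: FactGroup_def)

lemma zeroT: "\<zero>\<^bsub>T\<^esub> = cls 0"
  using F.coset_mult_one[of H] subgroup.subset[OF subH]
  unfolding tensor_product_def Let_def tensor_class_def by (simp add: FactGroup_def)

lemma rep: assumes "x \<in> carrier F" shows "tensor_rep (cls x) \<in> carrier F" "tensor_rep (cls x) - x \<in> H"
proof -
  have "x \<in> cls x" using cls_iff H_zero by simp
  then have "tensor_rep (cls x) \<in> cls x" unfolding tensor_rep_def by (rule someI)
  then show *: "tensor_rep (cls x) - x \<in> H" by (simp add: cls_iff)
  show "tensor_rep (cls x) \<in> carrier F"
    using F.m_closed[OF H_sub[OF *] assms] by simp
qed

lemma abelian: "abelian_group T"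
proof (rule abelian_groupI)
  show "x \<oplus>\<^bsub>T\<^esub> y \<in> carrier T" if prems: "x \<in> carrier T" "y \<in> carrier T" for x y
    using prems F.m_closed by (auto simp only: carr addT mult_free_Abelian_group)
  show "\<zero>\<^bsub>T\<^esub> \<in> carrier T" using F.one_closed by (auto simp only: carr zeroT one_free_Abelian_group)
  show "x \<oplus>\<^bsub>T\<^esub> y \<oplus>\<^bsub>T\<^esub> z = x \<oplus>\<^bsub>T\<^esub> (y \<oplus>\<^bsub>T\<^esub> z)" if prems: "x \<in> carrier T" "y \<in> carrier T" "z \<in> carrier T" for x y z
  proof -
    obtain a where 1: "x = cls a" "a \<in> carrier F" using prems unfolding carr by blast
    obtain b where 2: "y = cls b" "b \<in> carrier F" using prems unfolding carr by blast
    obtain c where 3: "z = cls c" "c \<in> carrier F" using prems unfolding carr by blast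
    note s = 1(1) 2(1) 3(1) 1(2) 2(2) 3(2)
    have "a + b \<in> carrier F" "b + c \<in> carrier F" using F.m_closed[OF s(4,5)] F.m_closed[OF s(5,6)] by (simp_all only: mult_free_Abelian_group)
    then show ?thesis using s by (simp add: addT ac_simps del: carrier_free_Abelian_group_iff)
  qed
  show "x \<oplus>\<^bsub>T\<^esub> y = y \<oplus>\<^bsub>T\<^esub> x" if prems: "x \<in> carrier T" "y \<in> carrier T" for x y
    using prems by (auto simp only: carr addT add.commute)
  show "\<zero>\<^bsub>T\<^esub> \<oplus>\<^bsub>T\<^esub> x = x" if prems: "x \<in> carrier T" for x
    using prems F.one_closed by (auto simp: carr zeroT addT simp del: carrier_free_Abelian_group_iff)
  show "\<exists>y\<in>carrier T. y \<oplus>\<^bsub>T\<^esub> x = \<zero>\<^bsub>T\<^esub>" if prems: "x \<in> carrier T" for x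
  proof -
    obtain a where a: "x = cls a" "a \<in> carrier F" using prems unfolding carr by blast
    then have "- a \<in> carrier F" by simp
    then show ?thesis using a by (intro bexI[of _ "cls (-a)"]) (auto simp: addT zeroT carr simp del: carrier_free_Abelian_group_iff)
  qed
qed

sublocale T: abelian_group T by (rule abelian)

lemma ext_null:
  fixes g :: "'b \<times> 'c \<Rightarrow> 'z \<Rightarrow>\<^sub>0 int"
  assumes K0: "0 \<in> K" and Kd: "\<And>x y. x \<in> K \<Longrightarrow> y \<in> K \<Longrightarrow> x - y \<in> K"
    and g: "\<And>z. z \<in> tensor_relations R M N \<Longrightarrow> frag_extend g z \<in> K"
    and h: "h \<in> H"
  shows "frag_extend g h \<in> K"
proof -
  have Kn: "- x \<in> K" if "x \<in> K" for x using Kd[OF K0 that] by simp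
  have Ka: "x + y \<in> K" if "x \<in> K" "y \<in> K" for x y using Kd[OF that(1) Kn[OF that(2)]] by simp
  show ?thesis using h unfolding tensor_null_def
  proof (induction rule: generate.induct)
    case one then show ?case using K0 by simp
  next
    case (incl x) then show ?case using g by simp
  next
    case (inv x)
    then have "inv\<^bsub>F\<^esub> x = - x" using subsetD[OF rel_sub, of x] by (intro inv_free_Abelian_group) simp
    then show ?case using g[OF inv] Kn by (simp add: frag_extend_minus)
  next
    case (eng x y) then show ?case using Ka by (simp add: frag_extend_add)
  qed
qed

lemma rel1: "x \<in> carrier M \<Longrightarrow> x' \<in> carrier M \<Longrightarrow> y \<in> carrier N \<Longrightarrow> frag_of (x \<oplus>\<^bsub>M\<^esub> x', y) - (frag_of (x, y) + frag_of (x', y)) \<in> H"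
  unfolding tensor_null_def by (rule generate.incl) (auto simp: tensor_relations_def)
lemma rel2: "x \<in> carrier M \<Longrightarrow> y \<in> carrier N \<Longrightarrow> y' \<in> carrier N \<Longrightarrow> frag_of (x, y \<oplus>\<^bsub>N\<^esub> y') - (frag_of (x, y) + frag_of (x, y')) \<in> H"
  unfolding tensor_null_def by (rule generate.incl) (auto simp: tensor_relations_def)
lemma rel3: "c \<in> carrier R \<Longrightarrow> x \<in> carrier M \<Longrightarrow> y \<in> carrier N \<Longrightarrow> frag_of (c \<odot>\<^bsub>M\<^esub> x, y) - frag_of (x, c \<odot>\<^bsub>N\<^esub> y) \<in> H"
  unfolding tensor_null_def by (rule generate.incl) (auto simp: tensor_relations_def)

lemma frag_of_F: "x \<in> carrier M \<Longrightarrow> y \<in> carrier N \<Longrightarrow> frag_of (x,y) \<in> carrier F" by (simp add: keys_frag_of)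

lemma pure_closed: "x \<in> carrier M \<Longrightarrow> y \<in> carrier N \<Longrightarrow> pure x y \<in> carrier T"
  using frag_of_F unfolding carr pure_tensor_def by blast

definition "scale_frag c = (\<lambda>(x, y). frag_of (c \<odot>\<^bsub>M\<^esub> x, y ))" for c

lemma smT: assumes "c \<in> carrier R" "x \<in> carrier F"
  shows "c \<odot>\<^bsub>T\<^esub> cls x = cls (frag_extend (scale_frag c) x)"
proof -
  have "frag_extend (scale_frag c) (tensor_rep (cls x) - x) \<in> H"
    apply (rule ext_null[OF H_zero H_diff _ rep(2)[OF assms(2)]], assumption, assumption)
    using assms(1) unfolding tensor_relations_def
    apply (auto simp: scale_frag_def frag_extend_diff frag_extend_add M.smult_r_distr rel1 rel2)
    subgoal for d z y using rel3[of d "c \<odot>\<^bsub>M\<^esub> z" y] M.smult_assoc1[of c d z] M.smult_assoc1[of d c z] M.R.m_comm[of c d] by simp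
    done
  then show ?thesis unfolding tensor_product_def Let_def by (simp add: cls_eq frag_extend_diff scale_frag_def)
qed

lemma scale_frag_tn: "c \<in> carrier R \<Longrightarrow> x \<in> carrier M \<Longrightarrow> y \<in> carrier N \<Longrightarrow> c \<odot>\<^bsub>T\<^esub> pure x y = pure (c \<odot>\<^bsub>M\<^esub> x) y"
  using smT[OF _ frag_of_F] by (simp add: pure_tensor_def scale_frag_def)

lemma pure_bilinear: "bilinear_map R M N T pure"
  unfolding bilinear_map_def
  apply (intro conjI ballI)
       apply (simp add: pure_closed)
  subgoal using rel1 frag_of_F by (simp add: pure_tensor_def addT cls_eq del: carrier_free_Abelian_group_iff)
  subgoal using rel2 frag_of_F by (simp add: pure_tensor_def addT cls_eq del: carrier_free_Abelian_group_iff)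
   apply (simp add: scale_frag_tn)
  subgoal for c x y using rel3[of c x y] H_neg[OF rel3[of c x y]]
    by (simp add: scale_frag_tn) (simp add: pure_tensor_def cls_eq)
  done

lemma scale_frag_F: "c \<in> carrier R \<Longrightarrow> x \<in> carrier F \<Longrightarrow> frag_extend (scale_frag c) x \<in> carrier F"
proof -
  assume a: "c \<in> carrier R" "x \<in> carrier F"
  have "frag_extend (scale_frag c) x \<in> carrier F" using a(2)[unfolded F_iff]
  proof (induction rule: frag_induction)
    case zero show ?case by simp
    case (one x) then show ?case using a(1) by (auto simp: scale_frag_def keys_frag_of)
  next
    case (diff a b) then show ?case using keys_diff by (fastforce simp: frag_extend_diff)
  qed
  then show ?thesis .
qed

lemma scale_frag_eqI:
  assumes "x \<in> carrier F" "\<And>p q. p \<in> carrier M \<Longrightarrow> q \<in> carrier N \<Longrightarrow> \<phi> (frag_of (p,q)) \<in> H"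
    "\<phi> 0 = 0" "\<And>x y. \<phi> (x - y) = \<phi> x - \<phi> y"
  shows "\<phi> x \<in> H"
  using assms(1)[unfolded F_iff]
  by (induction rule: frag_induction) (auto simp: assms H_zero intro: H_diff)

lemma smT_closed: "c \<in> carrier R \<Longrightarrow> X \<in> carrier T \<Longrightarrow> c \<odot>\<^bsub>T\<^esub> X \<in> carrier T"
  using scale_frag_F by (auto simp: carr smT simp del: carrier_free_Abelian_group_iff)

lemma moduleT: "module R T"
proof (rule moduleI)
  show "cring R" by (rule M.R.cring_axioms)
  show "abelian_group T" by (rule abelian)
  show "c \<odot>\<^bsub>T\<^esub> X \<in> carrier T" if prems: "c \<in> carrier R" "X \<in> carrier T" for c X using prems by (rule smT_closed)
  show "(c \<oplus> d) \<odot>\<^bsub>T\<^esub> X = c \<odot>\<^bsub>T\<^esub> X \<oplus>\<^bsub>T\<^esub> d \<odot>\<^bsub>T\<^esub> X" if prems: "c \<in> carrier R" "d \<in> carrier R" "X \<in> carrier T" for c d X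
  proof -
    obtain x where x: "X = cls x" "x \<in> carrier F" using prems unfolding carr by blast
    have "frag_extend (scale_frag (c \<oplus> d)) x - (frag_extend (scale_frag c) x + frag_extend (scale_frag d) x) \<in> H"
      by (rule scale_frag_eqI[OF x(2)]) (use prems in \<open>auto simp: frag_extend_diff scale_frag_def M.smult_l_distr rel1\<close>)
    then show ?thesis using x prems scale_frag_F by (simp add: smT addT cls_eq del: carrier_free_Abelian_group_iff)
  qed
  show "c \<odot>\<^bsub>T\<^esub> (X \<oplus>\<^bsub>T\<^esub> Y) = c \<odot>\<^bsub>T\<^esub> X \<oplus>\<^bsub>T\<^esub> c \<odot>\<^bsub>T\<^esub> Y" if prems: "c \<in> carrier R" "X \<in> carrier T" "Y \<in> carrier T" for c X Y
  proof -
    obtain x where x: "X = cls x" "x \<in> carrier F" using prems unfolding carr by blast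
    obtain y where y: "Y = cls y" "y \<in> carrier F" using prems unfolding carr by blast
    have "x + y \<in> carrier F" using F.m_closed[OF x(2) y(2)] by simp
    then show ?thesis using x y prems scale_frag_F by (simp add: smT addT frag_extend_add del: carrier_free_Abelian_group_iff)
  qed
  show "(c \<otimes> d) \<odot>\<^bsub>T\<^esub> X = c \<odot>\<^bsub>T\<^esub> (d \<odot>\<^bsub>T\<^esub> X)" if prems: "c \<in> carrier R" "d \<in> carrier R" "X \<in> carrier T" for c d X
  proof -
    obtain x where x: "X = cls x" "x \<in> carrier F" using prems unfolding carr by blast
    have "frag_extend (scale_frag (c \<otimes> d)) x - frag_extend (scale_frag c) (frag_extend (scale_frag d) x) \<in> H"
      by (rule scale_frag_eqI[OF x(2)]) (use prems in \<open>auto simp: frag_extend_diff scale_frag_def M.smult_assoc1 H_zero\<close>)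
    then show ?thesis using x prems scale_frag_F by (simp add: smT cls_eq del: carrier_free_Abelian_group_iff)
  qed
  show "\<one> \<odot>\<^bsub>T\<^esub> X = X" if prems: "X \<in> carrier T" for X
  proof -
    obtain x where x: "X = cls x" "x \<in> carrier F" using prems unfolding carr by blast
    have "frag_extend (scale_frag \<one>) x - x \<in> H"
      by (rule scale_frag_eqI[OF x(2)]) (auto simp: frag_extend_diff scale_frag_def H_zero)
    then show ?thesis using x scale_frag_F by (simp add: smT cls_eq del: carrier_free_Abelian_group_iff)
  qed
qed

lemma frag_eval_hom:
  fixes P :: "('p, 'q) ring_scheme" and S :: "'x set"
  assumes "abelian_group P" "f \<in> S \<rightarrow> carrier P"
  shows "frag_eval P f \<in> hom (free_Abelian_group S) (add_monoid P)"
    and "x \<in> S \<Longrightarrow> frag_eval P f (frag_of x) = f x"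
proof -
  interpret P: abelian_group P by fact
  have ge: "frag_eval P f x = gfinprod (add_monoid P) (\<lambda>p. [poly_mapping.lookup x p] \<cdot>\<^bsub>P\<^esub> f p) S" if "Poly_Mapping.keys x \<subseteq> S" for x
  proof -
    have fin: "finite {p \<in> S. [poly_mapping.lookup x p] \<cdot>\<^bsub>P\<^esub> f p \<noteq> \<zero>\<^bsub>P\<^esub>}"
      by (rule finite_subset[OF _ finite_keys[of x]]) (auto simp: in_keys_iff add_pow_def)
    have c: "[poly_mapping.lookup x p] \<cdot>\<^bsub>P\<^esub> f p \<in> carrier P" if "p \<in> Poly_Mapping.keys x" for p
      using that \<open>Poly_Mapping.keys x \<subseteq> S\<close> assms(2) by (intro P.add.int_pow_closed) auto
    have z: "p \<in> Poly_Mapping.keys x" if "[poly_mapping.lookup x p] \<cdot>\<^bsub>P\<^esub> f p \<noteq> \<zero>\<^bsub>P\<^esub>" for p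
      using that by (rule contrapos_np) (simp add: in_keys_iff add_pow_def)
    have "frag_eval P f x = (\<Oplus>\<^bsub>P\<^esub>p\<in>{p \<in> S. [poly_mapping.lookup x p] \<cdot>\<^bsub>P\<^esub> f p \<noteq> \<zero>\<^bsub>P\<^esub>}. [poly_mapping.lookup x p] \<cdot>\<^bsub>P\<^esub> f p)"
      unfolding frag_eval_def
      by (rule P.add.finprod_mono_neutral_cong_right) (use \<open>Poly_Mapping.keys x \<subseteq> S\<close> c z in auto)
    also have "\<dots> = gfinprod (add_monoid P) (\<lambda>p. [poly_mapping.lookup x p] \<cdot>\<^bsub>P\<^esub> f p) S"
      using fin by (simp add: gfinprod_def finsum_def)
    finally show ?thesis .
  qed
  show "frag_eval P f \<in> hom (free_Abelian_group S) (add_monoid P)"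
  proof (rule homI)
    fix x y assume xy: "x \<in> carrier (free_Abelian_group S)" "y \<in> carrier (free_Abelian_group S)"
    have fin: "finite {p \<in> S. [poly_mapping.lookup x p] \<cdot>\<^bsub>P\<^esub> f p \<noteq> \<zero>\<^bsub>P\<^esub>}" for x :: "'x \<Rightarrow>\<^sub>0 int"
      by (rule finite_subset[OF _ finite_keys[of x]]) (auto simp: in_keys_iff add_pow_def)
    have k: "Poly_Mapping.keys (x+y) \<subseteq> S" using xy keys_add[of x y] by auto
    show "frag_eval P f (x \<otimes>\<^bsub>free_Abelian_group S\<^esub> y) = frag_eval P f x \<otimes>\<^bsub>add_monoid P\<^esub> frag_eval P f y"
      using xy k assms(2)
      apply (simp add: ge)
      apply (subst P.add.gfinprod_distrib[simplified, symmetric])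
          apply (auto simp: fin)
      apply (rule P.add.gfinprod_cong[simplified])
      by (auto simp: Poly_Mapping.lookup_add P.add.int_pow_mult simp_implies_def Pi_def)
  next
    fix x assume "x \<in> carrier (free_Abelian_group S)"
    then show "frag_eval P f x \<in> carrier (add_monoid P)" using assms(2)
      unfolding frag_eval_def by (auto intro!: P.finsum_closed)
  qed
  show "frag_eval P f (frag_of x) = f x" if prems: "x \<in> S"
  proof -
    have "f x \<in> carrier P" using prems assms(2) by auto
    then show ?thesis
      unfolding frag_eval_def keys_frag_of
      using P.finsum_insert[of "{}" x "\<lambda>p. [poly_mapping.lookup (frag_of x) p] \<cdot>\<^bsub>P\<^esub> f p"]
      by simp
  qed
qed

lemma lift_cls:
  assumes P: "module R P" and f: "bilinear_map R M N P f"
  shows "(\<lambda>x. tensor_lift P f (cls x)) \<in> hom F (add_monoid P)" (is ?A)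
    and "x \<in> carrier F \<Longrightarrow> tensor_lift P f (cls x) = frag_eval P (\<lambda>(x,y). f x y) x"
proof -
  interpret P: module R P by fact
  let ?f = "\<lambda>(x,y). f x y" let ?e = "frag_eval P ?f"
  have fS: "?f \<in> carrier M \<times> carrier N \<rightarrow> carrier P" using f by (auto simp: bilinear_map_def)
  note h = frag_eval_hom[OF P.abelian_group_axioms fS]
  have gh: "group_hom F (add_monoid P) ?e"
    unfolding group_hom_def group_hom_axioms_def using h(1) P.a_group by simp
  interpret e: group_hom F "add_monoid P" ?e by fact
  have ker: "subgroup (kernel F (add_monoid P) ?e) F" by (rule e.subgroup_kernel)
  have ed: "?e (x - y) = ?e x \<ominus>\<^bsub>P\<^esub> ?e y" if "x \<in> carrier F" "y \<in> carrier F" for x y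
  proof -
    have m: "-y \<in> carrier F" using that by simp
    have "?e (-y) = \<ominus>\<^bsub>P\<^esub> ?e y" using e.hom_inv[OF that(2)] that inv_free_Abelian_group[of y] by (simp add: a_inv_def)
    then show ?thesis using e.hom_mult[OF that(1) m] by (simp add: a_minus_def)
  qed
  have "tensor_relations R M N \<subseteq> kernel F (add_monoid P) ?e"
  proof
    fix z assume z: "z \<in> tensor_relations R M N"
    have "?e z = \<zero>\<^bsub>P\<^esub>" using z unfolding tensor_relations_def
    proof (elim UnE CollectE exE conjE)
      fix x x' y assume a: "z = frag_of (x \<oplus>\<^bsub>M\<^esub> x', y) - (frag_of (x, y) + frag_of (x', y))" "x \<in> carrier M" "x' \<in> carrier M" "y \<in> carrier N"
      have s: "frag_of (x, y) + frag_of (x', y) \<in> carrier F" "?e (frag_of (x, y) + frag_of (x', y)) = f x y \<oplus>\<^bsub>P\<^esub> f x' y"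
        using F.m_closed[OF frag_of_F[OF a(2,4)] frag_of_F[OF a(3,4)]] e.hom_mult[OF frag_of_F[OF a(2,4)] frag_of_F[OF a(3,4)]] a h(2)
        by simp_all
      show ?thesis unfolding a(1) using a(2-) s ed[OF frag_of_F[OF _ a(4)] s(1)] f
        by (simp add: h(2) bilinear_map_def P.M.r_neg a_minus_def del: carrier_free_Abelian_group_iff)
    next
      fix x y y' assume a: "z = frag_of (x, y \<oplus>\<^bsub>N\<^esub> y') - (frag_of (x, y) + frag_of (x, y'))" "x \<in> carrier M" "y \<in> carrier N" "y' \<in> carrier N"
      have s: "frag_of (x, y) + frag_of (x, y') \<in> carrier F" "?e (frag_of (x, y) + frag_of (x, y')) = f x y \<oplus>\<^bsub>P\<^esub> f x y'"
        using F.m_closed[OF frag_of_F[OF a(2,3)] frag_of_F[OF a(2,4)]] e.hom_mult[OF frag_of_F[OF a(2,3)] frag_of_F[OF a(2,4)]] a h(2)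
        by simp_all
      show ?thesis unfolding a(1) using a(2-) s ed[OF frag_of_F[OF a(2)] s(1)] f
        by (simp add: h(2) bilinear_map_def P.M.r_neg a_minus_def del: carrier_free_Abelian_group_iff)
    next
      fix c x y assume a: "z = frag_of (c \<odot>\<^bsub>M\<^esub> x, y) - frag_of (x, c \<odot>\<^bsub>N\<^esub> y)" "c \<in> carrier R" "x \<in> carrier M" "y \<in> carrier N"
      show ?thesis unfolding a(1) using a(2-) ed[OF frag_of_F frag_of_F] f
        by (simp add: h(2) bilinear_map_def P.M.r_neg a_minus_def del: carrier_free_Abelian_group_iff)
    qed
    then show "z \<in> kernel F (add_monoid P) ?e" using subsetD[OF rel_sub z] unfolding kernel_def by simp
  qed
  from F.generate_subgroup_incl[OF this ker] have HK: "?e h = \<zero>\<^bsub>P\<^esub>" if "h \<in> H" for h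
    using that unfolding tensor_null_def kernel_def by auto
  show *: "tensor_lift P f (cls x) = ?e x" if "x \<in> carrier F" for x
  proof -
    have "?e ((tensor_rep (cls x) - x) + x) = ?e (tensor_rep (cls x) - x) \<oplus>\<^bsub>P\<^esub> ?e x"
      using e.hom_mult[OF H_sub[OF rep(2)[OF that]] that] by simp
    then show ?thesis unfolding tensor_lift_def using HK[OF rep(2)[OF that]] e.hom_closed[OF that] by simp
  qed
  show ?A using h(1) F.m_closed by (auto simp: hom_def * simp del: carrier_free_Abelian_group_iff mult_free_Abelian_group)
qed

lemma tensor_lift_sum:
  assumes P: "module R P" and f: "bilinear_map R M N P f"
    and "finite I" "u \<in> I \<rightarrow> carrier M" "v \<in> I \<rightarrow> carrier N"
  shows "tensor_lift P f (\<Oplus>\<^bsub>T\<^esub>i\<in>I. pure (u i) (v i)) = (\<Oplus>\<^bsub>P\<^esub>i\<in>I. f (u i) (v i))"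
    and "(\<Oplus>\<^bsub>T\<^esub>i\<in>I. pure (u i) (v i)) = cls (\<Sum>i\<in>I. frag_of (u i, v i))"
    "(\<Sum>i\<in>I. frag_of (u i, v i)) \<in> carrier F"
proof -
  interpret P: module R P by fact
  have fS: "(\<lambda>(x,y). f x y) \<in> carrier M \<times> carrier N \<rightarrow> carrier P" using f by (auto simp: bilinear_map_def)
  note h = frag_eval_hom[OF P.abelian_group_axioms fS]
  have "(\<Sum>i\<in>I. frag_of (u i, v i)) \<in> carrier F \<and> (\<Oplus>\<^bsub>T\<^esub>i\<in>I. pure (u i) (v i)) = cls (\<Sum>i\<in>I. frag_of (u i, v i))
     \<and> tensor_lift P f (cls (\<Sum>i\<in>I. frag_of (u i, v i))) = (\<Oplus>\<^bsub>P\<^esub>i\<in>I. f (u i) (v i))"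
    using assms(3-)
  proof (induction I)
    case empty
    have "group_hom F (add_monoid P) (\<lambda>x. tensor_lift P f (cls x))"
      unfolding group_hom_def group_hom_axioms_def using lift_cls(1)[OF P f] P.a_group by simp
    from group_hom.hom_one[OF this] show ?case by (simp add: zeroT)
  next
    case (insert j I)
    then have uv: "u j \<in> carrier M" "v j \<in> carrier N" "u \<in> I \<rightarrow> carrier M" "v \<in> I \<rightarrow> carrier N" by auto
    note IH = insert.IH[OF uv(3,4)]
    have c: "frag_of (u j, v j) \<in> carrier F" using frag_of_F uv by blast
    have t: "(\<lambda>i. pure (u i) (v i)) \<in> I \<rightarrow> carrier T" "(\<lambda>i. f (u i) (v i)) \<in> I \<rightarrow> carrier P"
      using pure_closed uv f by (auto simp: Pi_iff bilinear_map_def)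
    show ?case
      using insert.hyps IH c t uv pure_closed[OF uv(1,2)] F.m_closed[OF c, of "\<Sum>i\<in>I. frag_of (u i, v i)"] hom_mult[OF lift_cls(1)[OF P f] c, of "\<Sum>i\<in>I. frag_of (u i, v i)"] f
      by (simp add: T.finsum_insert P.M.finsum_insert lift_cls(2)[OF P f c] h(2) pure_tensor_def addT bilinear_map_def
          del: carrier_free_Abelian_group_iff)
  qed
  then show "tensor_lift P f (\<Oplus>\<^bsub>T\<^esub>i\<in>I. pure (u i) (v i)) = (\<Oplus>\<^bsub>P\<^esub>i\<in>I. f (u i) (v i))"
     "(\<Oplus>\<^bsub>T\<^esub>i\<in>I. pure (u i) (v i)) = cls (\<Sum>i\<in>I. frag_of (u i, v i))"
    "(\<Sum>i\<in>I. frag_of (u i, v i)) \<in> carrier F" by auto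
qed

end

locale tensor_alg = tensor_pair R M N + MA: unital_algebra R M + NA: unital_algebra R N
  for R :: "('k, 'r) ring_scheme" (structure)
  and M :: "('k, 'b, 'm) module_scheme" and N :: "('k, 'c, 'n) module_scheme"
begin

definition mult_frag :: "('b \<times> 'c \<Rightarrow>\<^sub>0 int) \<Rightarrow> ('b \<times> 'c \<Rightarrow>\<^sub>0 int) \<Rightarrow> ('b \<times> 'c \<Rightarrow>\<^sub>0 int)" where
  "mult_frag x y = frag_extend (\<lambda>(a, b). frag_extend (\<lambda>(a', b'). frag_of (a \<otimes>\<^bsub>M\<^esub> a', b \<otimes>\<^bsub>N\<^esub> b')) y) x"

lemma mult_frag_0 [simp]: "mult_frag 0 y = 0" "mult_frag x 0 = 0"
  by (auto simp: mult_frag_def case_prod_unfold frag_extend_eq_0)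
lemma mult_frag_diffl: "mult_frag (x - x') y = mult_frag x y - mult_frag x' y" by (simp add: mult_frag_def frag_extend_diff)
lemma mult_frag_addl: "mult_frag (x + x') y = mult_frag x y + mult_frag x' y" by (simp add: mult_frag_def frag_extend_add)
lemma mult_frag_diffr: "mult_frag x (y - y') = mult_frag x y - mult_frag x y'"
  by (rule frag_induction[of x UNIV]) (simp, simp, (simp add: mult_frag_def case_prod_unfold frag_extend_diff), (simp add: mult_frag_diffl))
lemma mult_frag_addr: "mult_frag x (y + y') = mult_frag x y + mult_frag x y'"
  using mult_frag_diffr[of x y "-y'"] mult_frag_diffr[of x 0 y'] by simp
lemma mult_frag_of [simp]: "mult_frag (frag_of (a,b)) (frag_of (a',b')) = frag_of (a \<otimes>\<^bsub>M\<^esub> a', b \<otimes>\<^bsub>N\<^esub> b')" by (simp add: mult_frag_def)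

lemma F_diff: "x \<in> carrier F \<Longrightarrow> y \<in> carrier F \<Longrightarrow> x - y \<in> carrier F"
  using keys_diff[of x y] by auto

lemma mult_frag_F: assumes "x \<in> carrier F" "y \<in> carrier F" shows "mult_frag x y \<in> carrier F"
  using assms(1)[unfolded F_iff]
proof (induction rule: frag_induction)
  case zero then show ?case using F.one_closed by simp
next
  case (diff a b) then show ?case using F_diff by (simp only: mult_frag_diffl)
next
  case (one p)
  show ?case using assms(2)[unfolded F_iff]
  proof (induction rule: frag_induction)
    case zero then show ?case using F.one_closed by simp
  next
    case (diff a b) then show ?case using F_diff by (simp only: mult_frag_diffr)
  next
    case (one q) then show ?case using \<open>p \<in> _\<close> by (auto simp: keys_frag_of)
  qed
qed

lemma mult_frag_Hl: assumes "h \<in> H" "y \<in> carrier F" shows "mult_frag h y \<in> H"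
  using assms(2)[unfolded F_iff]
proof (induction rule: frag_induction)
  case zero then show ?case by (simp add: H_zero)
next
  case (diff a b) then show ?case by (simp add: mult_frag_diffr H_diff)
next
  case (one q)
  obtain a' b' where q: "q = (a', b')" "a' \<in> carrier M" "b' \<in> carrier N" using one by auto
  show ?case unfolding mult_frag_def
    apply (rule ext_null[OF H_zero H_diff _ assms(1)], assumption, assumption)
    unfolding tensor_relations_def using q
    by (auto simp: frag_extend_diff frag_extend_add MA.l_distr NA.l_distr rel1 rel2 rel3 MA.smult_mult_left NA.smult_mult_left)
qed

lemma mult_frag_Hr: assumes "h \<in> H" "y \<in> carrier F" shows "mult_frag y h \<in> H"
  using assms(2)[unfolded F_iff]
proof (induction rule: frag_induction)
  case zero then show ?case by (simp add: H_zero)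
next
  case (diff a b) then show ?case by (simp add: mult_frag_diffl H_diff)
next
  case (one q)
  obtain a' b' where q: "q = (a', b')" "a' \<in> carrier M" "b' \<in> carrier N" using one by auto
  show ?case unfolding mult_frag_def q apply simp
    apply (rule ext_null[OF H_zero H_diff _ assms(1)], assumption, assumption)
    unfolding tensor_relations_def using q
    by (auto simp: frag_extend_diff frag_extend_add MA.r_distr NA.r_distr rel1 rel2 rel3 MA.smult_mult_right NA.smult_mult_right)
qed

lemma multT: assumes "x \<in> carrier F" "y \<in> carrier F" shows "cls x \<otimes>\<^bsub>T\<^esub> cls y = cls (mult_frag x y)"
proof -
  let ?x = "tensor_rep (cls x)" let ?y = "tensor_rep (cls y)"
  have "mult_frag ?x ?y - mult_frag x y = mult_frag (?x - x) ?y + mult_frag x (?y - y)" by (simp add: mult_frag_diffl mult_frag_diffr)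
  also have "\<dots> \<in> H" by (intro H_add mult_frag_Hl mult_frag_Hr rep assms)
  finally show ?thesis by (simp add: tensor_product_def Let_def cls_eq mult_frag_def)
qed

lemma oneT: "\<one>\<^bsub>T\<^esub> = cls (frag_of (\<one>\<^bsub>M\<^esub>, \<one>\<^bsub>N\<^esub>))" by (simp add: tensor_product_def Let_def pure_tensor_def)

lemma mult_pure: "\<lbrakk>a \<in> carrier M; a' \<in> carrier M; b \<in> carrier N; b' \<in> carrier N\<rbrakk> \<Longrightarrow>
   pure a b \<otimes>\<^bsub>T\<^esub> pure a' b' = pure (a \<otimes>\<^bsub>M\<^esub> a') (b \<otimes>\<^bsub>N\<^esub> b')"
  by (simp add: pure_tensor_def multT frag_of_F del: carrier_free_Abelian_group_iff)

lemma F_ind: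
  assumes "x \<in> carrier F" "\<phi> 0 = (0::'z::ab_group_add)" "\<And>x y. \<phi> (x - y) = \<phi> x - \<phi> y"
    "\<And>p q. p \<in> carrier M \<Longrightarrow> q \<in> carrier N \<Longrightarrow> \<phi> (frag_of (p,q)) = 0"
  shows "\<phi> x = 0"
  using assms(1)[unfolded F_iff]
  by (induction rule: frag_induction) (auto simp: assms)

lemma mult_frag_assoc: assumes "x \<in> carrier F" "y \<in> carrier F" "z \<in> carrier F" shows "mult_frag (mult_frag x y) z = mult_frag x (mult_frag y z)"
proof -
  have 1: "mult_frag (mult_frag (frag_of (a,b)) (frag_of (a',b'))) z - mult_frag (frag_of (a,b)) (mult_frag (frag_of (a',b')) z) = 0"
    if "a \<in> carrier M" "b \<in> carrier N" "a' \<in> carrier M" "b' \<in> carrier N" for a b a' b'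
    by (rule F_ind[OF assms(3)]) (use that in \<open>auto simp: mult_frag_diffr MA.m_assoc NA.m_assoc simp del: mult_frag_of\<close>, simp add: MA.m_assoc NA.m_assoc)
  have 2: "mult_frag (mult_frag (frag_of (a,b)) y) z - mult_frag (frag_of (a,b)) (mult_frag y z) = 0"
    if "a \<in> carrier M" "b \<in> carrier N" for a b
    by (rule F_ind[OF assms(2)]) (use that 1 in \<open>auto simp: mult_frag_diffl mult_frag_diffr simp del: mult_frag_of\<close>)
  have "mult_frag (mult_frag x y) z - mult_frag x (mult_frag y z) = 0"
    by (rule F_ind[OF assms(1)]) (use 2 in \<open>auto simp: mult_frag_diffl mult_frag_diffr\<close>)
  then show ?thesis by simp
qed

lemma carE: assumes "X \<in> carrier T" obtains x where "X = cls x" "x \<in> carrier F"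
  using assms unfolding carr by (rule imageE)

lemma tensor_algebra: "unital_algebra R T"
proof -
  interpret TM: module R T by (rule moduleT)
  have Fa: "x + y \<in> carrier F" if "x \<in> carrier F" "y \<in> carrier F" for x y using F.m_closed[OF that] by (simp only: mult_free_Abelian_group)
  have o: "frag_of (\<one>\<^bsub>M\<^esub>, \<one>\<^bsub>N\<^esub>) \<in> carrier F" using frag_of_F by blast
  have o1: "mult_frag (frag_of (\<one>\<^bsub>M\<^esub>, \<one>\<^bsub>N\<^esub>)) x - x = 0" "mult_frag x (frag_of (\<one>\<^bsub>M\<^esub>, \<one>\<^bsub>N\<^esub>)) - x = 0" if "x \<in> carrier F" for x
    by (rule F_ind[OF that]; auto simp: mult_frag_diffl mult_frag_diffr)+
  note [simp del] = carrier_free_Abelian_group_iff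
  have r: "ring T"
  proof (rule ringI[OF abelian])
    show "Group.monoid T"
    proof (rule monoidI, goal_cases)
      case (1 X Y) then show ?case by (elim carE) (auto simp: multT carr mult_frag_F)
    next
      case 2 then show ?case using o by (auto simp: oneT carr)
    next
      case (3 X Y Z) then show ?case by (elim carE) (auto simp: multT mult_frag_F mult_frag_assoc)
    next
      case (4 X) then show ?case using o o1 by (elim carE) (auto simp: multT oneT)
    next
      case (5 X) then show ?case using o o1 by (elim carE) (auto simp: multT oneT)
    qed
    show "(X \<oplus>\<^bsub>T\<^esub> Y) \<otimes>\<^bsub>T\<^esub> Z = X \<otimes>\<^bsub>T\<^esub> Z \<oplus>\<^bsub>T\<^esub> Y \<otimes>\<^bsub>T\<^esub> Z" if "X \<in> carrier T" "Y \<in> carrier T" "Z \<in> carrier T" for X Y Z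
      using that by (elim carE) (auto simp: multT addT Fa mult_frag_F mult_frag_addl)
    show "Z \<otimes>\<^bsub>T\<^esub> (X \<oplus>\<^bsub>T\<^esub> Y) = Z \<otimes>\<^bsub>T\<^esub> X \<oplus>\<^bsub>T\<^esub> Z \<otimes>\<^bsub>T\<^esub> Y" if "X \<in> carrier T" "Y \<in> carrier T" "Z \<in> carrier T" for X Y Z
      using that by (elim carE) (auto simp: multT addT Fa mult_frag_F mult_frag_addr)
  qed
  have sd: "frag_extend (scale_frag c) (x - y) = frag_extend (scale_frag c) x - frag_extend (scale_frag c) y" for c and x y :: "'b \<times> 'c \<Rightarrow>\<^sub>0 int" by (rule frag_extend_diff)
  have s1: "mult_frag (frag_extend (scale_frag c) x) y - frag_extend (scale_frag c) (mult_frag x y) = 0" if "c \<in> carrier R" "x \<in> carrier F" "y \<in> carrier F" for c x y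
  proof (rule F_ind[OF that(2)], simp, simp add: sd mult_frag_diffl)
    fix p q assume pq: "p \<in> carrier M" "q \<in> carrier N"
    show "mult_frag (frag_extend (scale_frag c) (frag_of (p, q))) y - frag_extend (scale_frag c) (mult_frag (frag_of (p, q)) y) = 0"
      by (rule F_ind[OF that(3)]) (use pq that(1) in \<open>auto simp: frag_extend_diff mult_frag_diffr scale_frag_def MA.smult_mult_left\<close>)
  qed
  have s2: "mult_frag x (frag_extend (scale_frag c) y) - frag_extend (scale_frag c) (mult_frag x y) = 0" if "c \<in> carrier R" "x \<in> carrier F" "y \<in> carrier F" for c x y
  proof (rule F_ind[OF that(2)], simp, simp add: sd mult_frag_diffl)
    fix p q assume pq: "p \<in> carrier M" "q \<in> carrier N"
    show "mult_frag (frag_of (p, q)) (frag_extend (scale_frag c) y) - frag_extend (scale_frag c) (mult_frag (frag_of (p, q)) y) = 0"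
      by (rule F_ind[OF that(3)]) (use pq that(1) in \<open>auto simp: frag_extend_diff mult_frag_diffr scale_frag_def MA.smult_mult_right\<close>)
  qed
  have ax: "unital_algebra_axioms R T"
  proof
    fix c X Y assume "c \<in> carrier R" "X \<in> carrier T" "Y \<in> carrier T"
    then show "c \<odot>\<^bsub>T\<^esub> X \<otimes>\<^bsub>T\<^esub> Y = c \<odot>\<^bsub>T\<^esub> (X \<otimes>\<^bsub>T\<^esub> Y)" "X \<otimes>\<^bsub>T\<^esub> (c \<odot>\<^bsub>T\<^esub> Y) = c \<odot>\<^bsub>T\<^esub> (X \<otimes>\<^bsub>T\<^esub> Y)"
      using s1 s2 by (elim carE; auto simp: multT smT scale_frag_F mult_frag_F)+
  qed
  show ?thesis unfolding unital_algebra_def using r ax moduleT by simp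
qed
end

context unital_algebra begin
lemma leg_sums: assumes "finite I" "u \<in> I \<rightarrow> carrier M" "v \<in> I \<rightarrow> carrier M"
  and r: "r = (\<Oplus>\<^bsub>tensor2 R M\<^esub>i\<in>I. pure_tensor R M M (u i) (v i))"
  shows "leg12 R M r = (\<Oplus>\<^bsub>tensor3 R M\<^esub>i\<in>I. pure_tensor3 R M (u i) (v i) \<one>\<^bsub>M\<^esub>)"
    "leg13 R M r = (\<Oplus>\<^bsub>tensor3 R M\<^esub>i\<in>I. pure_tensor3 R M (u i) \<one>\<^bsub>M\<^esub> (v i))"
    "leg23 R M r = (\<Oplus>\<^bsub>tensor3 R M\<^esub>i\<in>I. pure_tensor3 R M \<one>\<^bsub>M\<^esub> (u i) (v i))"
proof -
  interpret T2: tensor_alg R M M by unfold_locales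
  interpret A2: unital_algebra R "tensor2 R M" by (rule T2.tensor_algebra)
  interpret T3: tensor_alg R "tensor2 R M" M by unfold_locales
  note b = T2.pure_bilinear[unfolded bilinear_map_def] T3.pure_bilinear[unfolded bilinear_map_def]
  show "leg12 R M r = (\<Oplus>\<^bsub>tensor3 R M\<^esub>i\<in>I. pure_tensor3 R M (u i) (v i) \<one>\<^bsub>M\<^esub>)"
    unfolding leg12_def r
    by (rule T2.tensor_lift_sum(1)[OF T3.moduleT _ assms(1-3)]) (use b in \<open>simp add: bilinear_map_def pure_tensor3_def\<close>)
  show "leg13 R M r = (\<Oplus>\<^bsub>tensor3 R M\<^esub>i\<in>I. pure_tensor3 R M (u i) \<one>\<^bsub>M\<^esub> (v i))"
    unfolding leg13_def r
    by (rule T2.tensor_lift_sum(1)[OF T3.moduleT _ assms(1-3)]) (use b in \<open>simp add: bilinear_map_def pure_tensor3_def\<close>)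
  show "leg23 R M r = (\<Oplus>\<^bsub>tensor3 R M\<^esub>i\<in>I. pure_tensor3 R M \<one>\<^bsub>M\<^esub> (u i) (v i))"
    unfolding leg23_def r
    by (rule T2.tensor_lift_sum(1)[OF T3.moduleT _ assms(1-3)]) (use b in \<open>simp add: bilinear_map_def pure_tensor3_def\<close>)
qed
end

end

theory Submission
  imports Defs "HOL-Algebra.AbelCoset"
begin

text \<open>
  Put \<open>L a = \<Sum>\<^sub>i u\<^sub>i a v\<^sub>i\<close>, so that \<open>a \<succ> b = L a b\<close> and \<open>a \<prec> b = a L b - \<lambda> a b\<close>.
  Applying \<open>x \<otimes> y \<otimes> z \<mapsto> x a y b z\<close> to the Yang-Baxter equation gives
  \<open>L (L a b) - L a L b + L (a L b) = \<lambda> L (a b)\<close>, i.e. \<open>L\<close> is a Rota-Baxter operator of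
  weight \<open>-\<lambda>\<close>; the dendriform axioms are then a direct computation.
\<close>

section \<open>Dendriform algebras from Rota-Baxter operators\<close>

text \<open>The Rota-Baxter identity amounts to \<open>L (prec x y + succ x y) = L x L y\<close>.
  This turns \<open>prec_prec\<close> and \<open>succ_succ\<close> into associativity and the scalar
  laws, and \<open>succ_prec\<close> follows from those laws alone. The operations enter through
  their values on the carrier only, so any formulas agreeing there may be supplied.\<close>

lemma (in unital_algebra) dendriform_of_Rota_Baxter:
  fixes prec succ
  assumes lam: "lam \<in> carrier R"
    and L: "\<And>x. x \<in> carrier M \<Longrightarrow> L x \<in> carrier M"
    and L_add: "\<And>x y. \<lbrakk>x \<in> carrier M; y \<in> carrier M\<rbrakk> \<Longrightarrow> L (x \<oplus>\<^bsub>M\<^esub> y) = L x \<oplus>\<^bsub>M\<^esub> L y"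
    and L_smult: "\<And>c x. \<lbrakk>c \<in> carrier R; x \<in> carrier M\<rbrakk> \<Longrightarrow> L (c \<odot>\<^bsub>M\<^esub> x) = c \<odot>\<^bsub>M\<^esub> L x"
    and RB: "\<And>x y. \<lbrakk>x \<in> carrier M; y \<in> carrier M\<rbrakk> \<Longrightarrow>
      L (L x \<otimes>\<^bsub>M\<^esub> y) \<ominus>\<^bsub>M\<^esub> L x \<otimes>\<^bsub>M\<^esub> L y \<oplus>\<^bsub>M\<^esub> L (x \<otimes>\<^bsub>M\<^esub> L y) = lam \<odot>\<^bsub>M\<^esub> L (x \<otimes>\<^bsub>M\<^esub> y)"
    and prec: "\<And>x y. \<lbrakk>x \<in> carrier M; y \<in> carrier M\<rbrakk> \<Longrightarrow>
      prec x y = x \<otimes>\<^bsub>M\<^esub> L y \<ominus>\<^bsub>M\<^esub> lam \<odot>\<^bsub>M\<^esub> (x \<otimes>\<^bsub>M\<^esub> y)"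
    and succ: "\<And>x y. \<lbrakk>x \<in> carrier M; y \<in> carrier M\<rbrakk> \<Longrightarrow> succ x y = L x \<otimes>\<^bsub>M\<^esub> y"
  shows "dendriform_algebra R M prec succ"
proof -
  have L_minus: "L (\<ominus>\<^bsub>M\<^esub> x) = \<ominus>\<^bsub>M\<^esub> L x" if x: "x \<in> carrier M" for x
  proof -
    have "L x \<oplus>\<^bsub>M\<^esub> L (\<ominus>\<^bsub>M\<^esub> x) = L (\<zero>\<^bsub>M\<^esub>)"
      using x L_add[of x "\<ominus>\<^bsub>M\<^esub> x"] by (simp add: r_neg)
    also have "L (\<zero>\<^bsub>M\<^esub>) = \<zero>\<^bsub>M\<^esub>"
      using L_add[of "\<zero>\<^bsub>M\<^esub>" "\<zero>\<^bsub>M\<^esub>"] L[of "\<zero>\<^bsub>M\<^esub>"] by simp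
    finally show ?thesis
      using x L by (metis a_inv_closed minus_equality a_comm)
  qed
  \<comment> \<open>The Rota-Baxter identity in multiplicative form: \<open>L\<close> takes the sum
    of the two dendriform products to the product in \<open>M\<close>.\<close>
  have LL: "L (x \<otimes>\<^bsub>M\<^esub> L y \<ominus>\<^bsub>M\<^esub> lam \<odot>\<^bsub>M\<^esub> (x \<otimes>\<^bsub>M\<^esub> y) \<oplus>\<^bsub>M\<^esub> L x \<otimes>\<^bsub>M\<^esub> y) = L x \<otimes>\<^bsub>M\<^esub> L y"
    if x: "x \<in> carrier M" "y \<in> carrier M" for x y
  proof -
    let ?p = "L (L x \<otimes>\<^bsub>M\<^esub> y)" and ?q = "L (x \<otimes>\<^bsub>M\<^esub> L y)" and ?t = "L x \<otimes>\<^bsub>M\<^esub> L y"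
    have c: "?p \<in> carrier M" "?q \<in> carrier M" "?t \<in> carrier M" using x L by simp_all
    \<comment> \<open>\<open>RB\<close> is read from right to left in effect: the term
      \<open>lam L (x y)\<close> becomes \<open>?p - ?t + ?q\<close>, after which only
      \<open>?t\<close> survives.\<close>
    have "L (x \<otimes>\<^bsub>M\<^esub> L y \<ominus>\<^bsub>M\<^esub> lam \<odot>\<^bsub>M\<^esub> (x \<otimes>\<^bsub>M\<^esub> y) \<oplus>\<^bsub>M\<^esub> L x \<otimes>\<^bsub>M\<^esub> y)
        = ?q \<ominus>\<^bsub>M\<^esub> (?p \<ominus>\<^bsub>M\<^esub> ?t \<oplus>\<^bsub>M\<^esub> ?q) \<oplus>\<^bsub>M\<^esub> ?p"
      using x lam L by (simp add: a_minus_def L_add L_minus L_smult RB[unfolded a_minus_def])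
    also have "\<dots> = ?t"
      using c by algebra
    finally show ?thesis .
  qed
  \<comment> \<open>Homogeneity of \<open>prec\<close> requires moving a scalar past
    \<open>lam\<close>; commutativity of \<open>R\<close> provides this.\<close>
  have sm: "c \<odot>\<^bsub>M\<^esub> (lam \<odot>\<^bsub>M\<^esub> x) = lam \<odot>\<^bsub>M\<^esub> (c \<odot>\<^bsub>M\<^esub> x)" if "c \<in> carrier R" "x \<in> carrier M" for c x
    using that lam by (metis smult_assoc1 R.m_comm)
  note simps = prec succ a_minus_def L L_add L_minus L_smult l_distr r_distr m_assoc smult_r_distr
    smult_mult_left smult_mult_right smult_r_minus minus_add a_ac l_minus r_minus
  show ?thesis
  \<comment> \<open>Goals 1 and 2 are bilinearity. In goals 3 and 5 the argument of the outer
    \<open>L\<close> is the sum of both products, so \<open>LL\<close> applies; goal 4 is pure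
    rearrangement.\<close>
  proof (unfold_locales, goal_cases)
    case 1 show ?case using lam by (auto simp: bilinear_map_def simps sm)
  next
    case 2 show ?case by (auto simp: bilinear_map_def simps)
  next
    case (3 a b c)
    then have "L (prec b c \<oplus>\<^bsub>M\<^esub> succ b c) = L b \<otimes>\<^bsub>M\<^esub> L c"
      by (simp add: prec succ LL)
    moreover have "prec b c \<in> carrier M" "succ b c \<in> carrier M" "prec a b \<in> carrier M"
      using 3 lam L by (simp_all add: prec succ)
    ultimately show ?case using 3 lam by (simp add: simps)
  next
    case (4 a b c) then show ?case using lam by (simp add: simps)
  next
    case (5 a b c)
    then have "L (prec a b \<oplus>\<^bsub>M\<^esub> succ a b) = L a \<otimes>\<^bsub>M\<^esub> L b"
      by (simp add: prec succ LL)
    then show ?case using 5 lam L by (simp add: succ prec m_assoc)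
  qed
qed

section \<open>Evaluating the Yang-Baxter equation\<close>

text \<open>Finiteness of the index set is not assumed: a sum over an infinite set is zero by
  convention, and \<open>h\<close> preserves zero.\<close>

lemma (in abelian_group_hom) hom_finsum:
  "f \<in> A \<rightarrow> carrier G \<Longrightarrow> h (\<Oplus>\<^bsub>G\<^esub>i\<in>A. f i) = (\<Oplus>\<^bsub>H\<^esub>i\<in>A. h (f i))"
  by (induction A rule: infinite_finite_induct) (auto simp: Pi_iff)

text \<open>Makes the lift of a bilinear map a linear map, so that an equation between tensors can
  be transported to \<open>P\<close>. Additivity comes from representatives; homogeneity reduces to
  pure tensors, where it is homogeneity of \<open>f\<close>.\<close>

lemma (in tensor_pair) tensor_lift_hom:
  assumes P: "module R P" and f: "bilinear_map R M N P f"
  shows "abelian_group_hom T P (tensor_lift P f)"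
    and "\<lbrakk>c \<in> carrier R; X \<in> carrier T\<rbrakk> \<Longrightarrow> tensor_lift P f (c \<odot>\<^bsub>T\<^esub> X) = c \<odot>\<^bsub>P\<^esub> tensor_lift P f X"
    and "\<lbrakk>x \<in> carrier M; y \<in> carrier N\<rbrakk> \<Longrightarrow> tensor_lift P f (pure x y) = f x y"
proof -
  interpret P: module R P by fact
  let ?L = "\<lambda>x. tensor_lift P f (cls x)"
  note h = lift_cls(1)[OF P f]
  have gh: "group_hom F (add_monoid P) ?L"
    unfolding group_hom_def group_hom_axioms_def using h P.a_group by simp
  have add: "?L (x + y) = ?L x \<oplus>\<^bsub>P\<^esub> ?L y" if "x \<in> carrier F" "y \<in> carrier F" for x y
    using hom_mult[OF h that] by simp
  have L: "?L x \<in> carrier P" if "x \<in> carrier F" for x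
    using hom_in_carrier[OF h that] by simp
  \<comment> \<open>\<open>frag_induction\<close> builds elements by differences, hence this form of
    additivity.\<close>
  have L_diff: "?L (x - y) = ?L x \<ominus>\<^bsub>P\<^esub> ?L y" if "x \<in> carrier F" "y \<in> carrier F" for x y
  proof -
    have m: "x - y \<in> carrier F" using that keys_diff[of x y] by auto
    then have "?L x = ?L (x - y) \<oplus>\<^bsub>P\<^esub> ?L y" using add[OF m that(2)] by simp
    then show ?thesis
      using L[OF m] L[OF that(2)] by (simp add: a_minus_def P.M.a_assoc P.M.r_neg)
  qed
  show "abelian_group_hom T P (tensor_lift P f)"
    by (intro abelian_group_homI group_hom.intro group_hom_axioms.intro homI
        T.abelian_group_axioms P.M.abelian_group_axioms T.a_group P.M.a_group)
      (auto simp: carr L addT add simp del: carrier_free_Abelian_group_iff)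
  \<comment> \<open>A pure tensor is a sum over the one-point index set \<open>{()}\<close>.\<close>
  show pure: "tensor_lift P f (pure x y) = f x y" if "x \<in> carrier M" "y \<in> carrier N" for x y
    using tensor_lift_sum(1)[OF P f, of "{()}" "\<lambda>_. x" "\<lambda>_. y"] that pure_closed[OF that] f
    by (simp add: bilinear_map_def)
  show "tensor_lift P f (c \<odot>\<^bsub>T\<^esub> X) = c \<odot>\<^bsub>P\<^esub> tensor_lift P f X" if c: "c \<in> carrier R" and "X \<in> carrier T"
  proof -
    obtain x where x: "X = cls x" "x \<in> carrier F" using \<open>X \<in> carrier T\<close> unfolding carr by blast
    \<comment> \<open>Membership is carried through the induction because the difference case needs
      both parts in \<open>F\<close>.\<close>
    have "x \<in> carrier F \<and> tensor_lift P f (c \<odot>\<^bsub>T\<^esub> cls x) = c \<odot>\<^bsub>P\<^esub> ?L x"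
      using x(2)[unfolded F_iff]
    proof (induction rule: frag_induction)
      case zero
      have z: "0 \<in> carrier F" by simp
      show ?case using z group_hom.hom_one[OF gh] c smT[OF c z] by simp
    next
      case (one p)
      then obtain a b where p: "p = (a, b)" "a \<in> carrier M" "b \<in> carrier N" by auto
      have "tensor_lift P f (c \<odot>\<^bsub>T\<^esub> pure a b) = c \<odot>\<^bsub>P\<^esub> tensor_lift P f (pure a b)"
        using p c f by (simp add: scale_frag_tn pure bilinear_map_def)
      then show ?case using p frag_of_F by (simp add: pure_tensor_def)
    next
      case (diff x y)
      then have xy: "x \<in> carrier F" "y \<in> carrier F" by blast+
      have d: "x - y \<in> carrier F" using xy keys_diff[of x y] by auto
      show ?case
        using diff xy d scale_frag_F[OF c] c L[OF xy(1)] L[OF xy(2)]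
        by (simp add: smT frag_extend_diff L_diff a_minus_def P.smult_r_distr P.smult_r_minus
            del: carrier_free_Abelian_group_iff)
    qed
    then show ?thesis using x(1) by simp
  qed
qed

text \<open>This is the operator \<open>L\<close> for a presentation of \<open>r\<close>: the image
  of \<open>r\<close> under the map from A \<otimes> A to End(A) that sends x \<otimes> y to the
  endomorphism taking a to x a y.\<close>

definition (in unital_algebra) sandwich where
  "sandwich I u v x = (\<Oplus>\<^bsub>M\<^esub>i\<in>I. u i \<otimes>\<^bsub>M\<^esub> x \<otimes>\<^bsub>M\<^esub> v i)"

lemma (in unital_algebra) sandwich_linear:
  assumes I: "finite I" "u \<in> I \<rightarrow> carrier M" "v \<in> I \<rightarrow> carrier M"
  shows sandwich_closed: "x \<in> carrier M \<Longrightarrow> sandwich I u v x \<in> carrier M"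
    and sandwich_add: "\<lbrakk>x \<in> carrier M; y \<in> carrier M\<rbrakk> \<Longrightarrow>
      sandwich I u v (x \<oplus>\<^bsub>M\<^esub> y) = sandwich I u v x \<oplus>\<^bsub>M\<^esub> sandwich I u v y"
    and sandwich_smult: "\<lbrakk>c \<in> carrier R; x \<in> carrier M\<rbrakk> \<Longrightarrow>
      sandwich I u v (c \<odot>\<^bsub>M\<^esub> x) = c \<odot>\<^bsub>M\<^esub> sandwich I u v x"
    and sandwich_finsum: "w \<in> J \<rightarrow> carrier M \<Longrightarrow>
      sandwich I u v (\<Oplus>\<^bsub>M\<^esub>j\<in>J. w j) = (\<Oplus>\<^bsub>M\<^esub>j\<in>J. sandwich I u v (w j))"
proof -
  have uv: "i \<in> I \<Longrightarrow> u i \<in> carrier M" "i \<in> I \<Longrightarrow> v i \<in> carrier M" for i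
    using I by auto
  show closed: "sandwich I u v x \<in> carrier M" if "x \<in> carrier M" for x
    using that uv unfolding sandwich_def by (auto intro!: finsum_closed)
  show add: "sandwich I u v (x \<oplus>\<^bsub>M\<^esub> y) = sandwich I u v x \<oplus>\<^bsub>M\<^esub> sandwich I u v y"
    if "x \<in> carrier M" "y \<in> carrier M" for x y
    using that uv by (simp add: sandwich_def l_distr r_distr finsum_addf Pi_iff cong: finsum_cong)
  show "sandwich I u v (c \<odot>\<^bsub>M\<^esub> x) = c \<odot>\<^bsub>M\<^esub> sandwich I u v x" if "c \<in> carrier R" "x \<in> carrier M"
    using that uv I(1) unfolding sandwich_def
    by (subst finsum_smult_ldistr)
      (auto intro!: finsum_cong' simp: smult_mult_left smult_mult_right)
  interpret L: abelian_group_hom M M "sandwich I u v"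
    by (intro abelian_group_homI group_hom.intro group_hom_axioms.intro homI
        M.abelian_group_axioms M.a_group) (simp_all add: closed add)
  show "sandwich I u v (\<Oplus>\<^bsub>M\<^esub>j\<in>J. w j) = (\<Oplus>\<^bsub>M\<^esub>j\<in>J. sandwich I u v (w j))" if "w \<in> J \<rightarrow> carrier M"
    using that by (rule L.hom_finsum)
qed

text \<open>Under x \<otimes> y \<otimes> z \<mapsto> x a y b z the products of legs become double
  sums: r13 r12 gives u_i u_j a v_j b v_i, r12 r23 gives u_i a v_i u_j b v_j, r23 r13 gives u_j a
  u_i b v_i v_j, and r13 gives u_i a b v_i. These are the four terms of the identity.\<close>

lemma (in unital_algebra) AYBE_imp_Rota_Baxter:
  assumes lam: "lam \<in> carrier R"
    and I: "finite I" "u \<in> I \<rightarrow> carrier M" "v \<in> I \<rightarrow> carrier M"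
    and aybe: "AYBE R M lam (\<Oplus>\<^bsub>tensor2 R M\<^esub>i\<in>I. pure_tensor R M M (u i) (v i))"
    and ab: "a \<in> carrier M" "b \<in> carrier M"
  defines "L \<equiv> sandwich I u v"
  shows "L (L a \<otimes>\<^bsub>M\<^esub> b) \<ominus>\<^bsub>M\<^esub> L a \<otimes>\<^bsub>M\<^esub> L b \<oplus>\<^bsub>M\<^esub> L (a \<otimes>\<^bsub>M\<^esub> L b) = lam \<odot>\<^bsub>M\<^esub> L (a \<otimes>\<^bsub>M\<^esub> b)"
proof -
  interpret T2: tensor_alg R M M by unfold_locales
  interpret A2: unital_algebra R "tensor2 R M" by (rule T2.tensor_algebra)
  interpret T3: tensor_alg R "tensor2 R M" M by unfold_locales
  interpret A3: unital_algebra R "tensor3 R M" by (rule T3.tensor_algebra)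
  have modM: "module R M" by unfold_locales
  \<comment> \<open>The evaluation map is built in two stages, following the left bracketing of
    \<open>tensor3\<close>: \<open>f\<close> sends x \<otimes> y to x a y b, then \<open>g\<close>
    multiplies by z on the right.\<close>
  define f where "f = (\<lambda>x y. x \<otimes>\<^bsub>M\<^esub> a \<otimes>\<^bsub>M\<^esub> y \<otimes>\<^bsub>M\<^esub> b)"
  have f: "bilinear_map R M M M f"
    using ab by (simp add: bilinear_map_def f_def l_distr r_distr m_assoc
        smult_mult_left smult_mult_right)
  note hf = T2.tensor_lift_hom[OF modM f]
  interpret hf: abelian_group_hom "tensor2 R M" M "tensor_lift M f" by (rule hf(1))
  define g where "g = (\<lambda>p z. tensor_lift M f p \<otimes>\<^bsub>M\<^esub> z)"
  have g: "bilinear_map R (tensor2 R M) M M g"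
    by (simp add: bilinear_map_def g_def l_distr r_distr hf(2)
        smult_mult_left smult_mult_right)
  note hg = T3.tensor_lift_hom[OF modM g]
  define \<Phi> where "\<Phi> = tensor_lift M g"
  interpret h: abelian_group_hom "tensor3 R M" M \<Phi> unfolding \<Phi>_def by (rule hg(1))
  let ?p = "pure_tensor3 R M"
  have p_closed: "?p x y z \<in> carrier (tensor3 R M)"
    if "x \<in> carrier M" "y \<in> carrier M" "z \<in> carrier M" for x y z
    using that by (simp add: pure_tensor3_def T2.pure_closed T3.pure_closed)
  have \<Phi>_p: "\<Phi> (?p x y z) = x \<otimes>\<^bsub>M\<^esub> a \<otimes>\<^bsub>M\<^esub> y \<otimes>\<^bsub>M\<^esub> b \<otimes>\<^bsub>M\<^esub> z"
    if "x \<in> carrier M" "y \<in> carrier M" "z \<in> carrier M" for x y z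
    using that unfolding \<Phi>_def pure_tensor3_def
    by (subst hg(3)) (simp_all add: T2.pure_closed g_def hf(3), simp add: f_def)
  have p_mult: "?p x y z \<otimes>\<^bsub>tensor3 R M\<^esub> ?p x' y' z' = ?p (x \<otimes>\<^bsub>M\<^esub> x') (y \<otimes>\<^bsub>M\<^esub> y') (z \<otimes>\<^bsub>M\<^esub> z')"
    if "x \<in> carrier M" "y \<in> carrier M" "z \<in> carrier M" "x' \<in> carrier M" "y' \<in> carrier M" "z' \<in> carrier M"
    for x y z x' y' z'
    using that by (simp add: pure_tensor3_def T2.pure_closed T3.mult_pure T2.mult_pure)
  have \<Phi>_sum: "\<Phi> (\<Oplus>\<^bsub>tensor3 R M\<^esub>i\<in>I. ?p (x i) (y i) (z i))
      = (\<Oplus>\<^bsub>M\<^esub>i\<in>I. x i \<otimes>\<^bsub>M\<^esub> a \<otimes>\<^bsub>M\<^esub> y i \<otimes>\<^bsub>M\<^esub> b \<otimes>\<^bsub>M\<^esub> z i)"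
    if "x \<in> I \<rightarrow> carrier M" "y \<in> I \<rightarrow> carrier M" "z \<in> I \<rightarrow> carrier M" for x y z
    using that ab
    by (subst h.hom_finsum) (auto intro!: finsum_cong' simp: Pi_iff p_closed \<Phi>_p)
  \<comment> \<open>\<open>\<Phi>\<close> is additive but in general not multiplicative, so a
    product of sums is first expanded inside \<open>tensor3\<close> and then evaluated term by
    term.\<close>
  have \<Phi>_prod: "\<Phi> ((\<Oplus>\<^bsub>tensor3 R M\<^esub>i\<in>I. ?p (x i) (y i) (z i)) \<otimes>\<^bsub>tensor3 R M\<^esub>
        (\<Oplus>\<^bsub>tensor3 R M\<^esub>j\<in>I. ?p (x' j) (y' j) (z' j)))
      = (\<Oplus>\<^bsub>M\<^esub>i\<in>I. \<Oplus>\<^bsub>M\<^esub>j\<in>I. (x i \<otimes>\<^bsub>M\<^esub> x' j) \<otimes>\<^bsub>M\<^esub> a \<otimes>\<^bsub>M\<^esub> (y i \<otimes>\<^bsub>M\<^esub> y' j) \<otimes>\<^bsub>M\<^esub> b \<otimes>\<^bsub>M\<^esub> (z i \<otimes>\<^bsub>M\<^esub> z' j))"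
    if xyz: "x \<in> I \<rightarrow> carrier M" "y \<in> I \<rightarrow> carrier M" "z \<in> I \<rightarrow> carrier M"
      "x' \<in> I \<rightarrow> carrier M" "y' \<in> I \<rightarrow> carrier M" "z' \<in> I \<rightarrow> carrier M" for x y z x' y' z'
  proof -
    have "(\<Oplus>\<^bsub>tensor3 R M\<^esub>i\<in>I. ?p (x i) (y i) (z i)) \<otimes>\<^bsub>tensor3 R M\<^esub>
        (\<Oplus>\<^bsub>tensor3 R M\<^esub>j\<in>I. ?p (x' j) (y' j) (z' j))
      = (\<Oplus>\<^bsub>tensor3 R M\<^esub>i\<in>I. ?p (x i) (y i) (z i) \<otimes>\<^bsub>tensor3 R M\<^esub>
        (\<Oplus>\<^bsub>tensor3 R M\<^esub>j\<in>I. ?p (x' j) (y' j) (z' j)))"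
      using xyz by (intro A3.finsum_ldistr I T3.T.finsum_closed) (auto simp: Pi_iff p_closed)
    also have "\<dots> = (\<Oplus>\<^bsub>tensor3 R M\<^esub>i\<in>I. \<Oplus>\<^bsub>tensor3 R M\<^esub>j\<in>I.
        ?p (x i \<otimes>\<^bsub>M\<^esub> x' j) (y i \<otimes>\<^bsub>M\<^esub> y' j) (z i \<otimes>\<^bsub>M\<^esub> z' j))"
    proof (intro T3.T.finsum_cong')
      fix i assume i: "i \<in> I"
      have "?p (x i) (y i) (z i) \<otimes>\<^bsub>tensor3 R M\<^esub> (\<Oplus>\<^bsub>tensor3 R M\<^esub>j\<in>I. ?p (x' j) (y' j) (z' j))
        = (\<Oplus>\<^bsub>tensor3 R M\<^esub>j\<in>I. ?p (x i) (y i) (z i) \<otimes>\<^bsub>tensor3 R M\<^esub> ?p (x' j) (y' j) (z' j))"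
        using xyz i by (intro A3.finsum_rdistr I) (auto simp: Pi_iff p_closed)
      also have "\<dots> = (\<Oplus>\<^bsub>tensor3 R M\<^esub>j\<in>I. ?p (x i \<otimes>\<^bsub>M\<^esub> x' j) (y i \<otimes>\<^bsub>M\<^esub> y' j) (z i \<otimes>\<^bsub>M\<^esub> z' j))"
        using xyz i by (intro T3.T.finsum_cong') (auto simp: Pi_iff p_closed p_mult)
      finally show "?p (x i) (y i) (z i) \<otimes>\<^bsub>tensor3 R M\<^esub> (\<Oplus>\<^bsub>tensor3 R M\<^esub>j\<in>I. ?p (x' j) (y' j) (z' j)) = \<dots>" .
    qed (use xyz in \<open>auto simp: Pi_iff p_closed intro!: T3.T.finsum_closed\<close>)
    finally show ?thesis
      using xyz ab
      by (simp, subst h.hom_finsum)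
        (auto intro!: finsum_cong' T3.T.finsum_closed finsum_closed \<Phi>_sum simp: Pi_iff p_closed)
  qed
  have u [simp]: "i \<in> I \<Longrightarrow> u i \<in> carrier M" and v [simp]: "i \<in> I \<Longrightarrow> v i \<in> carrier M" for i
    using I by auto
  have L [simp]: "L x \<in> carrier M" if "x \<in> carrier M" for x
    unfolding L_def by (rule sandwich_closed[OF I that])
  note expand = L_def sandwich_def finsum_rdistr finsum_ldistr m_assoc Pi_iff
  let ?r = "\<Oplus>\<^bsub>tensor2 R M\<^esub>i\<in>I. pure_tensor R M M (u i) (v i)"
  note legs = leg_sums[OF I refl]
  have leg_closed: "leg12 R M ?r \<in> carrier (tensor3 R M)" "leg13 R M ?r \<in> carrier (tensor3 R M)"
    "leg23 R M ?r \<in> carrier (tensor3 R M)"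
    unfolding legs using I by (auto intro!: T3.T.finsum_closed simp: p_closed)
  have "\<Phi> (leg13 R M ?r \<otimes>\<^bsub>tensor3 R M\<^esub> leg12 R M ?r) = L (L a \<otimes>\<^bsub>M\<^esub> b)"
    unfolding legs using I ab by (subst \<Phi>_prod) (auto simp: expand cong: finsum_cong)
  moreover have "\<Phi> (leg12 R M ?r \<otimes>\<^bsub>tensor3 R M\<^esub> leg23 R M ?r) = L a \<otimes>\<^bsub>M\<^esub> L b"
  proof -
    \<comment> \<open>Opening only the left factor makes its index the outer one, as in the double
      sum of \<open>\<Phi>_prod\<close>.\<close>
    have "L a \<otimes>\<^bsub>M\<^esub> L b = (\<Oplus>\<^bsub>M\<^esub>i\<in>I. (u i \<otimes>\<^bsub>M\<^esub> a \<otimes>\<^bsub>M\<^esub> v i) \<otimes>\<^bsub>M\<^esub> L b)"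
      using ab I by (subst L_def) (simp add: sandwich_def finsum_ldistr Pi_iff)
    then show ?thesis
      unfolding legs using I ab by (subst \<Phi>_prod) (auto simp: expand cong: finsum_cong)
  qed
  moreover have "\<Phi> (leg23 R M ?r \<otimes>\<^bsub>tensor3 R M\<^esub> leg13 R M ?r) = L (a \<otimes>\<^bsub>M\<^esub> L b)"
  proof -
    have "\<Phi> (leg23 R M ?r \<otimes>\<^bsub>tensor3 R M\<^esub> leg13 R M ?r)
      = (\<Oplus>\<^bsub>M\<^esub>i\<in>I. \<Oplus>\<^bsub>M\<^esub>j\<in>I. (\<one>\<^bsub>M\<^esub> \<otimes>\<^bsub>M\<^esub> u j) \<otimes>\<^bsub>M\<^esub> a \<otimes>\<^bsub>M\<^esub> (u i \<otimes>\<^bsub>M\<^esub> \<one>\<^bsub>M\<^esub>) \<otimes>\<^bsub>M\<^esub> b \<otimes>\<^bsub>M\<^esub> (v i \<otimes>\<^bsub>M\<^esub> v j))"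
      unfolding legs using I by (subst \<Phi>_prod) auto
    \<comment> \<open>Here the outer index belongs to the inner occurrence of \<open>L\<close>.
      Instead of interchanging sums, the sum over \<open>j\<close> is folded into \<open>L\<close>,
      and additivity of \<open>L\<close> absorbs the sum over \<open>i\<close>.\<close>
    also have "\<dots> = (\<Oplus>\<^bsub>M\<^esub>i\<in>I. L (a \<otimes>\<^bsub>M\<^esub> (u i \<otimes>\<^bsub>M\<^esub> b \<otimes>\<^bsub>M\<^esub> v i)))"
      using ab unfolding L_def sandwich_def by (auto intro!: finsum_cong' simp: m_assoc)
    also have "\<dots> = L (a \<otimes>\<^bsub>M\<^esub> L b)"
      using ab I
      by (subst sandwich_finsum[OF I, folded L_def, symmetric]) (auto simp: expand cong: finsum_cong)
    finally show ?thesis .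
  qed
  moreover have "\<Phi> (lam \<odot>\<^bsub>tensor3 R M\<^esub> leg13 R M ?r) = lam \<odot>\<^bsub>M\<^esub> L (a \<otimes>\<^bsub>M\<^esub> b)"
  proof -
    have "\<Phi> (leg13 R M ?r) = L (a \<otimes>\<^bsub>M\<^esub> b)"
      unfolding legs using I ab by (subst \<Phi>_sum) (auto simp: expand cong: finsum_cong)
    then show ?thesis using hg(2)[OF lam leg_closed(2)] by (simp add: \<Phi>_def)
  qed
  ultimately show ?thesis
    \<comment> \<open>\<open>\<Phi>\<close> is applied to both sides of the Yang-Baxter equation;
      closure of the legs lets it split over the three products.\<close>
    using aybe[unfolded AYBE_def, THEN arg_cong, of \<Phi>] leg_closed
    by (simp add: a_minus_def)
qed

section \<open>The dendriform structure given by a presentation of r\<close>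

theorem theorem5p6:
  fixes R :: "('k, 'm) ring_scheme"
    and A :: "('k, 'a, 'n) module_scheme"
    and lam :: 'k
    and r :: "'a tensor2"
    and I :: "'i set"
    and u v :: "'i \<Rightarrow> 'a"
  assumes "quasitriangular_inf_unitary_bialgebra R A lam r"
    and "finite I"
    and "u \<in> I \<rightarrow> carrier A"
    and "v \<in> I \<rightarrow> carrier A"
    and "r = (\<Oplus>\<^bsub>tensor2 R A\<^esub>i\<in>I. pure_tensor R A A (u i) (v i))"
  shows "dendriform_algebra R A
    (\<lambda>a b. (\<Oplus>\<^bsub>A\<^esub>i\<in>I. a \<otimes>\<^bsub>A\<^esub> u i \<otimes>\<^bsub>A\<^esub> b \<otimes>\<^bsub>A\<^esub> v i)
            \<ominus>\<^bsub>A\<^esub> lam \<odot>\<^bsub>A\<^esub> (a \<otimes>\<^bsub>A\<^esub> b))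
    (\<lambda>a b. \<Oplus>\<^bsub>A\<^esub>i\<in>I. u i \<otimes>\<^bsub>A\<^esub> a \<otimes>\<^bsub>A\<^esub> v i \<otimes>\<^bsub>A\<^esub> b)"
proof -
  interpret quasitriangular_inf_unitary_bialgebra R A lam r by (rule assms(1))
  let ?L = "sandwich I u v"
  have [simp]: "i \<in> I \<Longrightarrow> u i \<in> carrier A" "i \<in> I \<Longrightarrow> v i \<in> carrier A" for i
    using assms(3,4) by auto
  show ?thesis
  \<comment> \<open>Three goals remain: the Rota-Baxter identity, from the Yang-Baxter equation for
    the given presentation, and the two operations, where distributivity pulls \<open>a\<close> or
    \<open>b\<close> out of the sum and leaves \<open>?L\<close>.\<close>
  proof (rule dendriform_of_Rota_Baxter[OF weight_closed
    sandwich_closed[OF assms(2-4)] sandwich_add[OF assms(2-4)] sandwich_smult[OF assms(2-4)]])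
    fix a b assume ab: "a \<in> carrier A" "b \<in> carrier A"
    show "?L (?L a \<otimes>\<^bsub>A\<^esub> b) \<ominus>\<^bsub>A\<^esub> ?L a \<otimes>\<^bsub>A\<^esub> ?L b \<oplus>\<^bsub>A\<^esub> ?L (a \<otimes>\<^bsub>A\<^esub> ?L b) = lam \<odot>\<^bsub>A\<^esub> ?L (a \<otimes>\<^bsub>A\<^esub> b)"
      by (rule AYBE_imp_Rota_Baxter[OF weight_closed assms(2-4) aybe[unfolded assms(5)] ab])
    show "(\<Oplus>\<^bsub>A\<^esub>i\<in>I. a \<otimes>\<^bsub>A\<^esub> u i \<otimes>\<^bsub>A\<^esub> b \<otimes>\<^bsub>A\<^esub> v i) \<ominus>\<^bsub>A\<^esub> lam \<odot>\<^bsub>A\<^esub> (a \<otimes>\<^bsub>A\<^esub> b)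
        = a \<otimes>\<^bsub>A\<^esub> ?L b \<ominus>\<^bsub>A\<^esub> lam \<odot>\<^bsub>A\<^esub> (a \<otimes>\<^bsub>A\<^esub> b)"
      using ab assms(2) by (simp add: sandwich_def finsum_rdistr m_assoc Pi_iff cong: finsum_cong)
    show "(\<Oplus>\<^bsub>A\<^esub>i\<in>I. u i \<otimes>\<^bsub>A\<^esub> a \<otimes>\<^bsub>A\<^esub> v i \<otimes>\<^bsub>A\<^esub> b) = ?L a \<otimes>\<^bsub>A\<^esub> b"
      using ab assms(2) by (simp add: sandwich_def finsum_ldistr Pi_iff)
  qed
qed

end
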